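(* Let $\mathcal{X}$ be a finite state space, $H:\mathcal{X}\to\mathbb{R}$, $\beta\ge0$, and $\pi_\beta(x)=e^{-\beta H(x)}/\sum_z e^{-\beta H(z)}$. Let $P_\beta=P_\beta(N,H)$ be the transition matrix of the Metropolis-Hastings chain with ergodic reversible proposal $N$ and target distribution $\pi_\beta$, and let $Q \in \mathcal{I}(\pi_\beta) \cap \mathcal{L}$. Then: (1) (Similarity preserves critical height) $h(P_\beta) = h(Q P_\beta Q)$. (2) (Optimality of $\alpha=1/2$) For every $\alpha \in [0,1]$, $$ h(\overline{(P_\beta)}_\alpha(Q)) \leq h(P_\beta), \qquad\text{where } \overline{(P_\beta)}_\alpha(Q):=\alpha P_\beta+(1-\alpha)QP_\beta Q. $$ In particular, $$ \min_{\alpha \in [0,1]} h(\overline{(P_\beta)}_\alpha(Q)) = h(\overline{(P_\beta)}_{1/2}(Q)). $$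
   Context: $\mathcal{L}$ is the set of transition (row-stochastic) matrices on $\mathcal{X}$. $\mathcal{I}(\pi)$ is the set of real matrices $Q$ with $Q^2=I$ and $Q=Q^*$, where $Q^*(x,y)=\frac{\pi(y)}{\pi(x)}Q(y,x)$; the elements of $\mathcal{I}(\pi)\cap\mathcal{L}$ are exactly the permutation matrices $Q_\psi(x,y)=\delta_{y=\psi(x)}$ of involutions $\psi$ with $\pi(\psi(x))=\pi(x)$ for all $x$. The Metropolis-Hastings matrix with proposal $N$ is $P_\beta(N,H)(x,y)=N(x,y)e^{-\beta(H(y)-H(x))_+}$ for $x\ne y$, with $P_\beta(N,H)(x,x)=1-\sum_{z\ne x}P_\beta(N,H)(x,z)$. A path from $x$ to $y$ (for proposal $N$) is a finite sequence $\gamma=(x_0=x,x_1,\ldots,x_k=y)$ with $N(x_{i-1},x_i)>0$ for all $i$; $\mathrm{Elev}(\gamma)=\max_iH(x_i)$; $\mathbf{H}(x,y)$ is the minimum of $\mathrm{Elev}(\gamma)$ over all paths from $x$ to $y$. The critical height of $P_\beta(N,H)$ is $h(P_\beta(N,H)):=\max_{x,y\in\mathcal{X}}\{\mathbf{H}(x,y)-H(x)-H(y)\}+\min_zH(z)$. One has $\overline{(P_\beta)}_\alpha(Q)=P_\beta(\alpha N+(1-\alpha)QNQ,H)$ (in particular $QP_\beta Q=P_\beta(QNQ,H)$), and the critical heights of these matrices are those computed with the proposals $\alpha N+(1-\alpha)QNQ$ (respectively $QNQ$).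
   Formalization: For β=0 it is additionally assumed that Q preserves H (Q(x,y)≠0 implies H(x)=H(y)), since π_0 is uniform and the claim fails otherwise, e.g. H=(0,1,0), N a lazy symmetric walk on the path 1–2–3, Q swapping 1 and 2; nothing is added for β>0. *)

theory Defs
  imports "HOL-Analysis.Analysis"
begin

text \<open>
  The finite state space is a type of class \<^class>\<open>finite\<close>, matrices are of type
  \<open>real ^ 'a ^ 'a\<close> with entries \<open>A $ x $ y\<close>, and the matrix product is \<open>**\<close>
  (the operations \<open>*\<close> and \<open>^\<close> on this type are entrywise).
\<close>

definition transition_matrices :: "(real ^ 'a ^ 'a::finite) set" where
  "transition_matrices = {P. (\<forall>x y. 0 \<le> P $ x $ y) \<and> (\<forall>x. (\<Sum>y\<in>UNIV. P $ x $ y) = 1)}"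

definition weighted_adjoint :: "('a \<Rightarrow> real) \<Rightarrow> real ^ 'a ^ 'a \<Rightarrow> real ^ 'a ^ ('a::finite)" where
  "weighted_adjoint \<pi> Q = (\<chi> x y. \<pi> y / \<pi> x * Q $ y $ x)"

definition selfadjoint_involutions :: "('a \<Rightarrow> real) \<Rightarrow> (real ^ 'a ^ 'a::finite) set" where
  "selfadjoint_involutions \<pi> = {Q. Q ** Q = mat 1 \<and> Q = weighted_adjoint \<pi> Q}"

definition mat_power :: "real ^ 'a ^ 'a \<Rightarrow> nat \<Rightarrow> real ^ 'a ^ ('a::finite)" where
  "mat_power P n = (((**) P) ^^ n) (mat 1)"

definition irreducible_chain :: "real ^ 'a ^ ('a::finite) \<Rightarrow> bool" where
  "irreducible_chain P \<longleftrightarrow> (\<forall>x y. \<exists>n. mat_power P n $ x $ y > 0)"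

definition aperiodic_chain :: "real ^ 'a ^ ('a::finite) \<Rightarrow> bool" where
  "aperiodic_chain P \<longleftrightarrow> (\<forall>x. Gcd {n. n > 0 \<and> mat_power P n $ x $ x > 0} = 1)"

definition ergodic_chain :: "real ^ 'a ^ ('a::finite) \<Rightarrow> bool" where
  "ergodic_chain P \<longleftrightarrow> irreducible_chain P \<and> aperiodic_chain P"

text \<open>
  Reversibility with respect to some positive distribution; the case of a symmetric
  matrix is the one where \<open>\<mu>\<close> is uniform.
\<close>
definition reversible_chain :: "real ^ 'a ^ ('a::finite) \<Rightarrow> bool" where
  "reversible_chain P \<longleftrightarrow> (\<exists>\<mu>. (\<forall>x. 0 < \<mu> x) \<and> (\<Sum>x\<in>UNIV. \<mu> x) = 1 \<and>
     (\<forall>x y. \<mu> x * P $ x $ y = \<mu> y * P $ y $ x))"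

text \<open>
  For \<open>\<beta> > 0\<close> a stochastic self-adjoint involution with respect to this
  distribution only exchanges states of equal \<open>H\<close>. At \<open>\<beta> = 0\<close> the
  distribution is uniform and no longer sees \<open>H\<close>, so there the theorem has to
  ask for this invariance separately.
\<close>
definition gibbs :: "real \<Rightarrow> ('a::finite \<Rightarrow> real) \<Rightarrow> 'a \<Rightarrow> real" where
  "gibbs \<beta> H x = exp (- \<beta> * H x) / (\<Sum>z\<in>UNIV. exp (- \<beta> * H z))"

definition metropolis_hastings ::
    "real \<Rightarrow> real ^ 'a ^ 'a \<Rightarrow> ('a \<Rightarrow> real) \<Rightarrow> real ^ 'a ^ ('a::finite)" where
  "metropolis_hastings \<beta> N H = (\<chi> x y.
     if x = y then 1 - (\<Sum>z\<in>UNIV - {x}. N $ x $ z * exp (- \<beta> * max 0 (H z - H x)))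
     else N $ x $ y * exp (- \<beta> * max 0 (H y - H x)))"

text \<open>A path is its list of vertices; the one-point path from \<open>x\<close> to \<open>x\<close> is included.\<close>
definition is_path :: "real ^ 'a ^ 'a \<Rightarrow> 'a \<Rightarrow> 'a::finite list \<Rightarrow> 'a \<Rightarrow> bool" where
  "is_path N x \<gamma> y \<longleftrightarrow>
     \<gamma> \<noteq> [] \<and> hd \<gamma> = x \<and> last \<gamma> = y \<and> successively (\<lambda>u v. N $ u $ v > 0) \<gamma>"

definition elev :: "('a \<Rightarrow> real) \<Rightarrow> 'a list \<Rightarrow> real" where
  "elev H \<gamma> = Max (H ` set \<gamma>)"

text \<open>
  The elevations are values of \<open>H\<close>, so the set below is finite; it is nonempty
  for all \<open>x\<close>, \<open>y\<close> when \<open>N\<close> is irreducible.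
\<close>
definition min_elev :: "real ^ 'a ^ 'a \<Rightarrow> ('a::finite \<Rightarrow> real) \<Rightarrow> 'a \<Rightarrow> 'a \<Rightarrow> real" where
  "min_elev N H x y = Min {elev H \<gamma> | \<gamma>. is_path N x \<gamma> y}"

definition proposal_critical_height :: "real ^ 'a ^ 'a \<Rightarrow> ('a::finite \<Rightarrow> real) \<Rightarrow> real" where
  "proposal_critical_height N H =
     Max {min_elev N H x y - H x - H y | x y. True} + Min (range H)"

text \<open>
  The critical height of a Metropolis-Hastings matrix \<open>P\<close> is computed with its proposal,
  which \<open>P\<close>, \<open>\<beta>\<close> and \<open>H\<close> determine uniquely among the transition matrices
  (see \<open>metropolis_hastings_inject\<close> below).
\<close>
definition critical_height :: "real \<Rightarrow> ('a::finite \<Rightarrow> real) \<Rightarrow> real ^ 'a ^ 'a \<Rightarrow> real" where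
  "critical_height \<beta> H P = proposal_critical_height
     (THE N. N \<in> transition_matrices \<and> metropolis_hastings \<beta> N H = P) H"

lemma metropolis_hastings_inject:
  assumes "M \<in> transition_matrices" "N \<in> transition_matrices"
    and eq: "metropolis_hastings \<beta> M H = metropolis_hastings \<beta> N H"
  shows "M = N"
proof -
  have off: "M $ x $ y = N $ x $ y" if "x \<noteq> y" for x y
  proof -
    have "metropolis_hastings \<beta> M H $ x $ y = metropolis_hastings \<beta> N H $ x $ y"
      by (simp add: eq)
    with that show ?thesis by (simp add: metropolis_hastings_def)
  qed
  have diag: "A $ x $ x = 1 - (\<Sum>y\<in>UNIV - {x}. A $ x $ y)"
    if "A \<in> transition_matrices" for A :: "real ^ 'a ^ 'a" and x
  proof -
    have "(\<Sum>y\<in>UNIV. A $ x $ y) = A $ x $ x + (\<Sum>y\<in>UNIV - {x}. A $ x $ y)"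
      by (simp add: sum.remove)
    with that show ?thesis by (simp add: transition_matrices_def)
  qed
  have "(\<Sum>y\<in>UNIV - {x}. M $ x $ y) = (\<Sum>y\<in>UNIV - {x}. N $ x $ y)" for x
    by (rule sum.cong) (auto simp: off)
  then have "M $ x $ x = N $ x $ x" for x
    using diag assms(1,2) by simp
  with off have "M $ x $ y = N $ x $ y" for x y by (cases "x = y") auto
  then show ?thesis by (simp add: vec_eq_iff)
qed

lemma critical_height_metropolis_hastings:
  assumes "N \<in> transition_matrices"
  shows "critical_height \<beta> H (metropolis_hastings \<beta> N H) = proposal_critical_height N H"
proof -
  have "(THE M. M \<in> transition_matrices \<and> metropolis_hastings \<beta> M H = metropolis_hastings \<beta> N H) = N"
    using assms metropolis_hastings_inject by (intro the_equality) blast+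
  then show ?thesis by (simp add: critical_height_def)
qed

definition mixture :: "real ^ 'a ^ 'a \<Rightarrow> real \<Rightarrow> real ^ 'a ^ 'a \<Rightarrow> real ^ 'a ^ ('a::finite)" where
  "mixture P \<alpha> Q = \<alpha> *\<^sub>R P + (1 - \<alpha>) *\<^sub>R (Q ** P ** Q)"

end

theory Submission
  imports Defs
begin

text \<open>
  A stochastic matrix \<open>Q\<close> with \<open>Q ** Q = mat 1\<close> is the permutation matrix of an involution
  \<open>\<psi>\<close>, and self-adjointness forces \<open>H \<circ> \<psi> = H\<close>. Conjugation by \<open>Q\<close> therefore relabels
  the proposal along \<open>\<psi>\<close>, which maps paths to paths of the same elevation and leaves the
  critical height unchanged. A mixture with weight in \<open>{0<..<1}\<close> allows every transition of
  either proposal; more transitions mean more paths, hence a smaller critical height, and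
  the weight \<open>1/2\<close> allows all transitions that any weight in \<open>{0..1}\<close> does.
\<close>

definition relabel :: "('a \<Rightarrow> 'a) \<Rightarrow> real ^ 'a ^ 'a \<Rightarrow> real ^ 'a ^ ('a::finite)" where
  "relabel \<psi> A = (\<chi> x y. A $ \<psi> x $ \<psi> y)"

text \<open>The form in which irreducibility is used: every set of elevations in
  \<open>min_elev\<close> is nonempty, so that its \<open>Min\<close> is meaningful.\<close>

definition path_connected_chain :: "real ^ 'a ^ ('a::finite) \<Rightarrow> bool" where
  "path_connected_chain N \<longleftrightarrow> (\<forall>x y. \<exists>\<gamma>. is_path N x \<gamma> y)"

section \<open>Stochastic involutions\<close>

text \<open>For \<open>v \<noteq> x\<close> the entry of \<open>Q ** Q\<close> at
  \<open>(x, v)\<close> is 0 and is a sum of nonnegative terms, so the term through \<open>y\<close>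
  vanishes. Row \<open>y\<close> is thus concentrated at \<open>x\<close>, and it sums to 1.\<close>

lemma stochastic_involution_entry:
  assumes Q: "Q \<in> transition_matrices" and QQ: "Q ** Q = mat 1" and pos: "Q $ x $ y \<noteq> 0"
  shows "Q $ y $ x = 1"
proof -
  have nn: "0 \<le> Q $ u $ v" for u v
    using Q by (simp add: transition_matrices_def)
  have sum1: "(\<Sum>v\<in>UNIV. Q $ y $ v) = 1"
    using Q by (simp add: transition_matrices_def)
  have "Q $ y $ v = 0" if "v \<noteq> x" for v
  proof -
    have "(\<Sum>k\<in>UNIV. Q $ x $ k * Q $ k $ v) = (Q ** Q) $ x $ v"
      by (simp add: matrix_matrix_mult_def)
    also have "\<dots> = 0"
      using that by (simp add: QQ mat_def)
    finally have "\<forall>k\<in>UNIV. Q $ x $ k * Q $ k $ v = 0"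
      by (subst (asm) sum_nonneg_eq_0_iff) (auto simp: nn)
    then show ?thesis using pos by auto
  qed
  then have "(\<Sum>v\<in>UNIV. Q $ y $ v) = Q $ y $ x"
    by (simp add: sum.remove[of UNIV x])
  with sum1 show ?thesis by simp
qed

text \<open>Nonzero entries equal 1 and rows sum to 1, so each row has exactly one of them;
  \<open>\<psi> x\<close> is its column. Symmetry of the support makes \<open>\<psi>\<close> an
  involution.\<close>

lemma stochastic_involution_obtains:
  assumes Q: "Q \<in> transition_matrices" and QQ: "Q ** Q = mat 1"
  obtains \<psi> where "\<And>x. \<psi> (\<psi> x) = x" "Q = (\<chi> x y. if y = \<psi> x then 1 else 0)"
proof -
  have sym: "Q $ y $ x = 1" if "Q $ x $ y \<noteq> 0" for x y
    using stochastic_involution_entry[OF Q QQ that] .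
  have sum1: "(\<Sum>y\<in>UNIV. Q $ x $ y) = 1" for x
    using Q by (simp add: transition_matrices_def)
  have "\<exists>y. Q $ x $ y \<noteq> 0" for x
    using sum1[of x] by (metis sum.neutral zero_neq_one)
  then obtain \<psi> where \<psi>: "Q $ x $ \<psi> x \<noteq> 0" for x by metis
  \<comment> \<open>The transposed entry is 1, hence nonzero; transposing once more returns to the
    original entry.\<close>
  have one: "Q $ x $ y = 1" if "Q $ x $ y \<noteq> 0" for x y
    using sym[of y x] sym[OF that] by simp
  have uniq: "y = \<psi> x" if "Q $ x $ y \<noteq> 0" for x y
  proof (rule ccontr)
    assume ne: "y \<noteq> \<psi> x"
    have "(\<Sum>v\<in>{y, \<psi> x}. Q $ x $ v) \<le> (\<Sum>v\<in>UNIV. Q $ x $ v)"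
      using Q by (intro sum_mono2) (auto simp: transition_matrices_def)
    then show False
      using ne one[OF that] one[OF \<psi>[of x]] sum1[of x] by simp
  qed
  have "\<psi> (\<psi> x) = x" for x
    using uniq[of "\<psi> x" x] sym[OF \<psi>[of x]] by simp
  moreover have "Q = (\<chi> x y. if y = \<psi> x then 1 else 0)"
    using uniq one \<psi> by (auto simp: vec_eq_iff)
  ultimately show thesis by (rule that)
qed

lemma gibbs_eq_iff:
  assumes "\<beta> \<noteq> 0"
  shows "gibbs \<beta> H x = gibbs \<beta> H y \<longleftrightarrow> H x = H y"
proof -
  have "(\<Sum>z\<in>UNIV. exp (- \<beta> * H z)) > 0"
    by (intro sum_pos) auto
  with assms show ?thesis
    by (simp add: gibbs_def)
qed

lemma gibbs_pos: "0 < gibbs \<beta> H x"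
  unfolding gibbs_def by (intro divide_pos_pos sum_pos) auto

text \<open>Left multiplication by \<open>Q\<close> permutes the rows by \<open>\<psi>\<close>;
  right multiplication permutes the columns by the inverse of \<open>\<psi>\<close>, which is
  \<open>\<psi>\<close> itself.\<close>

lemma conjugate_permutation_matrix:
  assumes inv: "\<And>x. \<psi> (\<psi> x) = x"
  defines "Q \<equiv> \<chi> x y. if y = \<psi> x then 1 else 0"
  shows "Q ** P ** Q = relabel \<psi> P"
proof -
  have left: "(Q ** A) $ x $ y = A $ \<psi> x $ y" for A x y
    by (simp add: matrix_matrix_mult_def Q_def if_distrib if_distribR cong: if_cong)
  have right: "(A ** Q) $ x $ y = A $ x $ \<psi> y" for A x y
  proof -
    have "(A ** Q) $ x $ y = (\<Sum>k\<in>UNIV. A $ x $ k * (if y = \<psi> k then 1 else 0))"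
      by (simp add: matrix_matrix_mult_def Q_def)
    also have "\<dots> = (\<Sum>k\<in>UNIV. if k = \<psi> y then A $ x $ k else 0)"
      by (rule sum.cong) (auto simp: inv)
    finally show ?thesis by simp
  qed
  show ?thesis
    by (simp add: vec_eq_iff relabel_def left right)
qed

section \<open>Metropolis-Hastings matrices of relabelled and mixed proposals\<close>

lemma relabel_transition_matrices:
  assumes "\<And>x. \<psi> (\<psi> x) = x" "N \<in> transition_matrices"
  shows "relabel \<psi> N \<in> transition_matrices"
proof -
  have "(\<Sum>y\<in>UNIV. N $ \<psi> x $ \<psi> y) = (\<Sum>y\<in>UNIV. N $ \<psi> x $ y)" for x
    by (rule sum.reindex_bij_witness[of _ \<psi> \<psi>]) (auto simp: assms)
  with assms(2) show ?thesis
    by (simp add: transition_matrices_def relabel_def)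
qed

text \<open>The acceptance factors depend only on values of \<open>H\<close>, which
  \<open>\<psi>\<close> keeps. Being a bijection, \<open>\<psi>\<close> respects the diagonal and
  reindexes the sum there.\<close>

lemma relabel_metropolis_hastings:
  assumes inv: "\<And>x. \<psi> (\<psi> x) = x" and H: "\<And>x. H (\<psi> x) = H x"
  shows "relabel \<psi> (metropolis_hastings \<beta> N H) = metropolis_hastings \<beta> (relabel \<psi> N) H"
proof -
  have eq: "\<psi> x = \<psi> y \<longleftrightarrow> x = y" for x y
    using inv by metis
  have "(\<Sum>z\<in>UNIV - {\<psi> x}. N $ \<psi> x $ z * exp (- \<beta> * max 0 (H z - H x))) =
      (\<Sum>z\<in>UNIV - {x}. N $ \<psi> x $ \<psi> z * exp (- \<beta> * max 0 (H z - H x)))" for x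
    by (rule sum.reindex_bij_witness[of _ \<psi> \<psi>]) (auto simp: inv H eq)
  then show ?thesis
    by (simp add: vec_eq_iff relabel_def metropolis_hastings_def H eq)
qed

lemma convex_comb_transition_matrices:
  assumes "M \<in> transition_matrices" "N \<in> transition_matrices" "0 \<le> \<alpha>" "\<alpha> \<le> 1"
  shows "\<alpha> *\<^sub>R M + (1 - \<alpha>) *\<^sub>R N \<in> transition_matrices"
  using assms
  by (simp add: transition_matrices_def sum.distrib flip: sum_distrib_left)

text \<open>Off-diagonal entries are linear in the proposal. Diagonal entries are affine in it,
  which suffices as the weights sum to 1.\<close>

lemma convex_comb_metropolis_hastings:
  "\<alpha> *\<^sub>R metropolis_hastings \<beta> M H + (1 - \<alpha>) *\<^sub>R metropolis_hastings \<beta> N H =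
    metropolis_hastings \<beta> (\<alpha> *\<^sub>R M + (1 - \<alpha>) *\<^sub>R N) H"
  by (simp add: vec_eq_iff metropolis_hastings_def distrib_right sum.distrib mult.assoc
      flip: sum_distrib_left) (simp add: algebra_simps)

section \<open>Paths and critical heights\<close>

text \<open>A positive entry of a power has a positive summand, which provides the first step of a
  path; induction on the exponent provides the rest.\<close>

lemma irreducible_imp_path_connected:
  assumes N: "N \<in> transition_matrices" and irr: "irreducible_chain N"
  shows "path_connected_chain N"
proof -
  have "\<exists>\<gamma>. is_path N x \<gamma> y" if "mat_power N n $ x $ y > 0" for n x y
    using that
  proof (induction n arbitrary: x)
    case 0
    then have "x = y"
      by (simp add: mat_power_def mat_def split: if_splits)
    then have "is_path N x [x] y"
      by (simp add: is_path_def)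
    then show ?case ..
  next
    case (Suc n)
    have "mat_power N (Suc n) $ x $ y = (\<Sum>z\<in>UNIV. N $ x $ z * mat_power N n $ z $ y)"
      by (simp add: mat_power_def matrix_matrix_mult_def)
    with Suc.prems have "\<not> (\<forall>z\<in>UNIV. N $ x $ z * mat_power N n $ z $ y \<le> 0)"
      using sum_nonpos[of UNIV "\<lambda>z. N $ x $ z * mat_power N n $ z $ y"] by auto
    then obtain z where "0 < N $ x $ z * mat_power N n $ z $ y"
      by (auto simp: not_le)
    \<comment> \<open>This excludes a positive product of two negative factors.\<close>
    moreover have "0 \<le> N $ x $ z"
      using N by (simp add: transition_matrices_def)
    ultimately have pos: "0 < N $ x $ z" "0 < mat_power N n $ z $ y"
      by (auto simp: zero_less_mult_iff)
    from Suc.IH[OF pos(2)] obtain \<gamma> where "is_path N z \<gamma> y" ..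
    with pos(1) have "is_path N x (x # \<gamma>) y"
      by (auto simp: is_path_def successively_Cons)
    then show ?case ..
  qed
  with irr show ?thesis
    unfolding path_connected_chain_def irreducible_chain_def by blast
qed

section \<open>Monotonicity in the set of allowed transitions\<close>

lemma is_path_mono:
  assumes "\<And>u v. N $ u $ v > 0 \<Longrightarrow> M $ u $ v > 0" "is_path N x \<gamma> y"
  shows "is_path M x \<gamma> y"
  using assms by (auto simp: is_path_def intro: successively_mono)

lemma path_connected_chain_mono:
  assumes "\<And>u v. N $ u $ v > 0 \<Longrightarrow> M $ u $ v > 0" "path_connected_chain N"
  shows "path_connected_chain M"
  using assms is_path_mono unfolding path_connected_chain_def by metis

text \<open>There may be infinitely many paths, but each elevation is one of the finitely many
  values of \<open>H\<close>.\<close>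

lemma finite_path_elevations: "finite {elev H \<gamma> | \<gamma>. is_path N x \<gamma> y}"
proof (rule finite_subset)
  show "{elev H \<gamma> | \<gamma>. is_path N x \<gamma> y} \<subseteq> range H"
  proof
    fix e assume "e \<in> {elev H \<gamma> | \<gamma>. is_path N x \<gamma> y}"
    then obtain \<gamma> where "e = elev H \<gamma>" "\<gamma> \<noteq> []"
      by (auto simp: is_path_def)
    then have "e \<in> H ` set \<gamma>"
      unfolding elev_def by (metis Max_in finite_imageI finite_set image_is_empty set_empty)
    then show "e \<in> range H" by blast
  qed
qed simp

text \<open>The minimum for \<open>M\<close> runs over a larger set of paths; connectedness of
  \<open>N\<close> keeps the smaller set nonempty.\<close>

lemma min_elev_antimono:
  assumes sub: "\<And>u v. N $ u $ v > 0 \<Longrightarrow> M $ u $ v > 0" and conn: "path_connected_chain N"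
  shows "min_elev M H x y \<le> min_elev N H x y"
  unfolding min_elev_def
proof (rule Min_antimono)
  show "{elev H \<gamma> | \<gamma>. is_path N x \<gamma> y} \<subseteq> {elev H \<gamma> | \<gamma>. is_path M x \<gamma> y}"
    using is_path_mono[OF sub] by blast
  show "{elev H \<gamma> | \<gamma>. is_path N x \<gamma> y} \<noteq> {}"
    using conn by (auto simp: path_connected_chain_def)
qed (rule finite_path_elevations)

lemma finite_critical_height_set:
  "finite {f x y :: real | (x::'a::finite) (y::'b::finite). True}"
proof -
  have "{f x y | x y. True} = range (\<lambda>(x, y). f x y)" by auto
  then show ?thesis by simp
qed

lemma proposal_critical_height_antimono:
  assumes "\<And>u v. N $ u $ v > 0 \<Longrightarrow> M $ u $ v > 0" "path_connected_chain N"
  shows "proposal_critical_height M H \<le> proposal_critical_height N H"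
proof -
  let ?S = "\<lambda>N. {min_elev N H x y - H x - H y | x y. True}"
  have "Max (?S M) \<le> Max (?S N)"
  proof (rule Max.boundedI)
    fix a assume "a \<in> ?S M"
    then obtain x y where a: "a = min_elev M H x y - H x - H y" by blast
    then have "a \<le> min_elev N H x y - H x - H y"
      using min_elev_antimono[OF assms] by simp
    also have "\<dots> \<le> Max (?S N)"
      by (rule Max_ge[OF finite_critical_height_set]) blast
    finally show "a \<le> Max (?S N)" .
  next
    show "finite (?S M)" by (rule finite_critical_height_set)
    show "?S M \<noteq> {}" by blast
  qed
  then show ?thesis by (simp add: proposal_critical_height_def)
qed

section \<open>Invariance under relabelling by an involution\<close>

lemma relabel_involution:
  assumes "\<And>x. \<psi> (\<psi> x) = x"
  shows "relabel \<psi> (relabel \<psi> N) = N"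
  by (simp add: relabel_def assms vec_eq_iff)

lemma is_path_map:
  assumes "is_path (relabel \<psi> N) x \<gamma> y"
  shows "is_path N (\<psi> x) (map \<psi> \<gamma>) (\<psi> y)"
  using assms by (auto simp: is_path_def relabel_def hd_map last_map successively_map)

text \<open>The converse is \<open>is_path_map\<close> for the relabelled matrix, since applying
  \<open>\<psi>\<close> twice restores both matrix and path.\<close>

lemma is_path_relabel_iff:
  assumes inv: "\<And>x. \<psi> (\<psi> x) = x"
  shows "is_path (relabel \<psi> N) x \<gamma> y \<longleftrightarrow> is_path N (\<psi> x) (map \<psi> \<gamma>) (\<psi> y)"
proof
  assume "is_path N (\<psi> x) (map \<psi> \<gamma>) (\<psi> y)"
  then have "is_path (relabel \<psi> (relabel \<psi> N)) (\<psi> x) (map \<psi> \<gamma>) (\<psi> y)"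
    by (simp add: relabel_involution inv)
  from is_path_map[OF this] show "is_path (relabel \<psi> N) x \<gamma> y"
    by (simp add: inv comp_def)
qed (rule is_path_map)

lemma path_connected_chain_relabel:
  assumes inv: "\<And>x. \<psi> (\<psi> x) = x" and conn: "path_connected_chain N"
  shows "path_connected_chain (relabel \<psi> N)"
  unfolding path_connected_chain_def
proof (intro allI)
  fix x y
  from conn obtain \<gamma> where "is_path N (\<psi> x) \<gamma> (\<psi> y)"
    by (auto simp: path_connected_chain_def)
  then have "is_path (relabel \<psi> N) x (map \<psi> \<gamma>) y"
    by (simp add: is_path_relabel_iff inv comp_def)
  then show "\<exists>\<gamma>. is_path (relabel \<psi> N) x \<gamma> y" ..
qed

text \<open>Mapping vertices by \<open>\<psi>\<close> is a bijection between the two sets of paths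
  that preserves elevation.\<close>

lemma min_elev_relabel:
  assumes inv: "\<And>x. \<psi> (\<psi> x) = x" and H: "\<And>x. H (\<psi> x) = H x"
  shows "min_elev (relabel \<psi> N) H x y = min_elev N H (\<psi> x) (\<psi> y)"
proof -
  have elev: "elev H (map \<psi> \<gamma>) = elev H \<gamma>" for \<gamma>
    by (simp add: elev_def image_image H)
  have "{elev H \<gamma> | \<gamma>. is_path (relabel \<psi> N) x \<gamma> y} = {elev H \<gamma> | \<gamma>. is_path N (\<psi> x) \<gamma> (\<psi> y)}"
  proof (intro equalityI subsetI)
    fix e assume "e \<in> {elev H \<gamma> | \<gamma>. is_path (relabel \<psi> N) x \<gamma> y}"
    then obtain \<gamma> where "e = elev H (map \<psi> \<gamma>)" "is_path N (\<psi> x) (map \<psi> \<gamma>) (\<psi> y)"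
      by (auto simp: elev is_path_relabel_iff inv)
    then show "e \<in> {elev H \<gamma> | \<gamma>. is_path N (\<psi> x) \<gamma> (\<psi> y)}" by blast
  next
    fix e assume "e \<in> {elev H \<gamma> | \<gamma>. is_path N (\<psi> x) \<gamma> (\<psi> y)}"
    then obtain \<gamma> where "e = elev H (map \<psi> \<gamma>)" "is_path (relabel \<psi> N) x (map \<psi> \<gamma>) y"
      by (auto simp: elev is_path_relabel_iff inv comp_def)
    then show "e \<in> {elev H \<gamma> | \<gamma>. is_path (relabel \<psi> N) x \<gamma> y}" by blast
  qed
  then show ?thesis by (simp add: min_elev_def)
qed

lemma proposal_critical_height_relabel:
  assumes inv: "\<And>x. \<psi> (\<psi> x) = x" and H: "\<And>x. H (\<psi> x) = H x"
  shows "proposal_critical_height (relabel \<psi> N) H = proposal_critical_height N H"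
proof -
  let ?f = "\<lambda>x y. min_elev N H x y - H x - H y"
  have "{min_elev (relabel \<psi> N) H x y - H x - H y | x y. True} = {?f (\<psi> x) (\<psi> y) | x y. True}"
    by (simp add: min_elev_relabel inv H)
  \<comment> \<open>The pair \<open>(x, y)\<close> on the right is reached from
    \<open>(\<psi> x, \<psi> y)\<close> on the left.\<close>
  also have "\<dots> = {?f x y | x y. True}"
    using inv by (intro equalityI subsetI; clarify) (blast, metis)
  finally show ?thesis by (simp add: proposal_critical_height_def)
qed

section \<open>Optimality of the weight one half\<close>

theorem proposition7p1:
  fixes H :: "'a::finite \<Rightarrow> real" and \<beta> :: real and N Q :: "real ^ 'a ^ 'a"
  assumes beta: "0 \<le> \<beta>"
    and N: "N \<in> transition_matrices" "ergodic_chain N" "reversible_chain N"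
    and Q: "Q \<in> selfadjoint_involutions (gibbs \<beta> H) \<inter> transition_matrices"
    and Q_infinite_temperature: "\<beta> = 0 \<Longrightarrow> \<forall>x y. Q $ x $ y \<noteq> 0 \<longrightarrow> H x = H y"
  defines "P \<equiv> metropolis_hastings \<beta> N H"
  shows "critical_height \<beta> H P = critical_height \<beta> H (Q ** P ** Q) \<and>
    (\<forall>\<alpha>\<in>{0..1}. critical_height \<beta> H (mixture P \<alpha> Q) \<le> critical_height \<beta> H P) \<and>
    is_arg_min (\<lambda>\<alpha>. critical_height \<beta> H (mixture P \<alpha> Q)) (\<lambda>\<alpha>. \<alpha> \<in> {0..1}) (1/2)"
proof -
  have Qt: "Q \<in> transition_matrices" and QQ: "Q ** Q = mat 1"
    and adj: "Q = weighted_adjoint (gibbs \<beta> H) Q"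
    using Q by (auto simp: selfadjoint_involutions_def)
  obtain \<psi> where inv: "\<And>x. \<psi> (\<psi> x) = x" and Q_eq: "Q = (\<chi> x y. if y = \<psi> x then 1 else 0)"
    using stochastic_involution_obtains[OF Qt QQ] by blast
  \<comment> \<open>For \<open>\<beta> = 0\<close> the Gibbs distribution is uniform and
    self-adjointness says nothing about \<open>H\<close>, so the separate hypothesis on
    \<open>Q\<close> is used.\<close>
  have H: "H (\<psi> x) = H x" for x
  proof (cases "\<beta> = 0")
    case True
    then have "Q $ x $ \<psi> x \<noteq> 0 \<longrightarrow> H x = H (\<psi> x)"
      using Q_infinite_temperature by blast
    moreover have "Q $ x $ \<psi> x \<noteq> 0" by (simp add: Q_eq)
    ultimately show ?thesis by simp
  next
    case False
    \<comment> \<open>Both entries of \<open>Q\<close> here are 1, so the ratio of the Gibbs weights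
      is 1.\<close>
    have "Q $ x $ \<psi> x = gibbs \<beta> H (\<psi> x) / gibbs \<beta> H x * Q $ \<psi> x $ x"
      using arg_cong[OF adj, of "\<lambda>A. A $ x $ \<psi> x"] by (simp add: weighted_adjoint_def)
    then have "gibbs \<beta> H (\<psi> x) = gibbs \<beta> H x"
      using gibbs_pos[of \<beta> H x] by (simp add: Q_eq inv)
    with False show ?thesis by (simp add: gibbs_eq_iff)
  qed
  define N' where "N' = relabel \<psi> N"
  define M where "M \<alpha> = \<alpha> *\<^sub>R N + (1 - \<alpha>) *\<^sub>R N'" for \<alpha> :: real
  let ?h = "\<lambda>N. proposal_critical_height N H"
  have N': "N' \<in> transition_matrices"
    unfolding N'_def by (rule relabel_transition_matrices[OF inv N(1)])
  have nonneg: "0 \<le> N $ u $ v" "0 \<le> N' $ u $ v" for u v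
    using N(1) N' by (auto simp: transition_matrices_def)
  have QPQ: "Q ** P ** Q = metropolis_hastings \<beta> N' H"
    unfolding Q_eq P_def N'_def conjugate_permutation_matrix[OF inv]
    by (rule relabel_metropolis_hastings) (simp_all add: inv H)
  have hN: "critical_height \<beta> H P = ?h N"
    unfolding P_def by (rule critical_height_metropolis_hastings[OF N(1)])
  have hN': "?h N' = ?h N"
    unfolding N'_def by (rule proposal_critical_height_relabel) (simp_all add: inv H)
  \<comment> \<open>The mixture is itself a Metropolis-Hastings matrix with the stochastic proposal
    \<open>M \<alpha>\<close>, so only proposals remain to be compared.\<close>
  have hM: "critical_height \<beta> H (mixture P \<alpha> Q) = ?h (M \<alpha>)" if "\<alpha> \<in> {0..1}" for \<alpha>
  proof -
    have "mixture P \<alpha> Q = metropolis_hastings \<beta> (M \<alpha>) H"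
      unfolding mixture_def QPQ M_def by (simp add: P_def convex_comb_metropolis_hastings)
    moreover have "M \<alpha> \<in> transition_matrices"
      unfolding M_def using that by (intro convex_comb_transition_matrices N(1) N') auto
    ultimately show ?thesis by (simp add: critical_height_metropolis_hastings)
  qed
  have connN: "path_connected_chain N"
    using N by (intro irreducible_imp_path_connected) (auto simp: ergodic_chain_def)
  have connN': "path_connected_chain N'"
    unfolding N'_def by (rule path_connected_chain_relabel[OF inv connN])
  have subM: "0 < M \<alpha> $ u $ v" if "0 < \<alpha>" "\<alpha> \<le> 1" "0 < N $ u $ v" for \<alpha> u v
    using that nonneg(2)[of u v] by (simp add: M_def add_pos_nonneg)
  have M0: "M 0 = N'" by (simp add: M_def)
  have connM: "path_connected_chain (M \<alpha>)" if "\<alpha> \<in> {0..1}" for \<alpha>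
  proof (cases "\<alpha> = 0")
    case True
    with connN' show ?thesis by (simp add: M0)
  next
    case False
    with that show ?thesis
      by (intro path_connected_chain_mono[OF subM connN]) auto
  qed
  \<comment> \<open>At \<open>\<alpha> = 0\<close> transitions of \<open>N\<close> may be lost, so
    monotonicity is replaced there by invariance under relabelling.\<close>
  have le: "?h (M \<alpha>) \<le> ?h N" if "\<alpha> \<in> {0..1}" for \<alpha>
  proof (cases "\<alpha> = 0")
    case True
    with hN' show ?thesis by (simp add: M0)
  next
    case False
    with that show ?thesis
      by (intro proposal_critical_height_antimono[OF subM connN]) auto
  qed
  \<comment> \<open>A transition of \<open>M \<alpha>\<close> comes from \<open>N\<close> or
    \<open>N'\<close>, and \<open>M (1/2)\<close> gives positive weight to both.\<close>
  have min: "?h (M (1/2)) \<le> ?h (M \<alpha>)" if \<alpha>: "\<alpha> \<in> {0..1}" for \<alpha>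
  proof (rule proposal_critical_height_antimono[OF _ connM[OF \<alpha>]])
    fix u v assume "0 < M \<alpha> $ u $ v"
    then have "N $ u $ v \<noteq> 0 \<or> N' $ u $ v \<noteq> 0"
      by (auto simp: M_def)
    then have "0 < N $ u $ v + N' $ u $ v"
      using nonneg[of u v] by linarith
    then show "0 < M (1/2) $ u $ v"
      by (simp add: M_def)
  qed
  have "critical_height \<beta> H P = critical_height \<beta> H (Q ** P ** Q)"
    by (simp add: QPQ hN hN' critical_height_metropolis_hastings[OF N'])
  moreover have "\<forall>\<alpha>\<in>{0..1}. critical_height \<beta> H (mixture P \<alpha> Q) \<le> critical_height \<beta> H P"
    using le by (simp add: hM hN)
  moreover have "is_arg_min (\<lambda>\<alpha>. critical_height \<beta> H (mixture P \<alpha> Q)) (\<lambda>\<alpha>. \<alpha> \<in> {0..1}) (1/2)"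
    using min by (auto simp: is_arg_min_linorder hM)
  ultimately show ?thesis by blast
qed

end
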